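(* Let $q\in\mathbb{C}$ with $\operatorname{Re} q>0$, and let $G_r\in\mathcal{J}_r$, where $r\operatorname{Re} q>r_0$. If $r\operatorname{Re} q\ge 6$ and $\theta\in\mathbb{R}$ satisfies $|\theta|\le\arccos\frac{6}{r\operatorname{Re} q}$, then $G_r$ is a $\theta$-spirallike function of order $$\alpha_{r,\theta}:=\frac{\cos\theta-A(r\operatorname{Re} q)}{(1-A^2(r\operatorname{Re} q))\cdot\cos\theta}.$$ Moreover, $G_r$ is starlike of order $\alpha_r:=\dfrac{1}{1+A(r\operatorname{Re} q)}$ and strongly starlike of order $\beta_r:=\dfrac2\pi\arcsin A(r\operatorname{Re} q)$.
   Context: $\mathbb{D}=\{z\in\mathbb{C}:|z|<1\}$. The function $A$ is defined by $A(x)=\dfrac{6x(1+x)}{(1+x)^3-3(5x-1)}$, $A^2(x)=(A(x))^2$, and $r_0$ is the largest real root of the equation $A(x)=1$, namely $r_0=1+2\sqrt7\cos\left(\frac13\arctan\frac{3\sqrt{31}}{8}\right)\approx 5.92434$. A holomorphic function $f:\mathbb{D}\to\mathbb{C}$ is called a generator if for every $z\in\mathbb{D}$ the Cauchy problem $\frac{\partial u(t,z)}{\partial t}+f(u(t,z))=0$, $u(0,z)=z$, has a unique solution $u(t,z)\in\mathbb{D}$ defined for all $t\ge 0$. For a generator $f$ and $r>0$, it is known that $(\mathrm{Id}+rf)(\mathbb{D})\supset\mathbb{D}$ and that $G_r:=(\mathrm{Id}+rf)^{-1}$ is a well-defined holomorphic (univalent) self-mapping of $\mathbb{D}$; it is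 called the nonlinear resolvent of $f$. For fixed $q\in\mathbb{C}$ with $\operatorname{Re} q>0$ and $r>0$, $\mathcal{J}_r$ denotes the family of all resolvents $G_r=(\mathrm{Id}+rf)^{-1}$ of generators $f$ with $f(0)=0$ and $f'(0)=q$. Let $h:\mathbb{D}\to\mathbb{C}$ be holomorphic with $h(0)=0$, $h'(0)\ne0$ (at $z=0$ the quotient $zh'(z)/h(z)$ is understood as $1$). Then $h$ is starlike of order $\alpha\in(0,1)$ if $\operatorname{Re}\frac{zh'(z)}{h(z)}>\alpha$ for all $z\in\mathbb{D}$; $h$ is $\theta$-spirallike of order $\alpha\in(0,1)$ if $\operatorname{Re}\left(e^{-i\theta}\frac{zh'(z)}{h(z)}\right)>\alpha\cos\theta$ for all $z\in\mathbb{D}$; $h$ is strongly starlike of order $\beta\in(0,1)$ if $\left|\arg\frac{zh'(z)}{h(z)}\right|<\frac{\pi\beta}{2}$ for all $z\in\mathbb{D}$. *)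

theory Defs
  imports "HOL-Complex_Analysis.Complex_Analysis"
begin

abbreviation unit_disc :: "complex set" where
  "unit_disc \<equiv> ball 0 1"

definition A_quot :: "real \<Rightarrow> real" where
  "A_quot x = 6 * x * (1 + x) / ((1 + x) ^ 3 - 3 * (5 * x - 1))"

definition r0 :: real where
  "r0 = (GREATEST x. A_quot x = 1)"

lemma A_quot_eq_1_iff: "A_quot x = 1 \<longleftrightarrow> (x - 1) ^ 3 - 21 * (x - 1) - 16 = 0"
proof -
  have den: "(1 + x) ^ 3 - 3 * (5 * x - 1) = 6 * x * (1 + x) + ((x - 1) ^ 3 - 21 * (x - 1) - 16)"
    by (simp add: power3_eq_cube algebra_simps)
  have nz: "6 * x * (1 + x) \<noteq> 0" if "(x - 1) ^ 3 - 21 * (x - 1) - 16 = 0"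
  proof
    assume "6 * x * (1 + x) = 0"
    then have "x = 0 \<or> x = -1" by (auto simp: add_eq_0_iff)
    then show False using that by (auto simp: power3_eq_cube)
  qed
  show ?thesis
    unfolding A_quot_def den using nz by (auto simp: divide_eq_1_iff)
qed

text \<open>The closed form of the largest root of \<open>A(x) = 1\<close>; in particular the root exists, so the
  use of \<open>GREATEST\<close> above is meaningful.\<close>

lemma r0_closed_form: "r0 = 1 + 2 * sqrt 7 * cos (arctan (3 * sqrt 31 / 8) / 3)"
  and A_quot_r0: "A_quot r0 = 1"
  and r0_largest: "A_quot x = 1 \<Longrightarrow> x \<le> r0"
proof -
  define t where "t = arctan (3 * sqrt 31 / 8) / 3"
  define y where "y = 2 * sqrt 7 * cos t"
  have s7: "sqrt 7 * sqrt 7 = (7::real)" by simp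
  have "cos (3 * t) = 4 * cos t ^ 3 - 3 * cos t" by (rule cos_treble_cos)
  moreover have "cos (3 * t) = 1 / sqrt (1 + (3 * sqrt 31 / 8)\<^sup>2)"
    unfolding t_def by (simp add: cos_arctan)
  moreover have "1 + (3 * sqrt 31 / 8)\<^sup>2 = (7 * sqrt 7 / 8)\<^sup>2"
    by (simp add: power_mult_distrib power_divide)
  then have "sqrt (1 + (3 * sqrt 31 / 8)\<^sup>2) = 7 * sqrt 7 / 8" by (metis abs_of_nonneg 
     divide_nonneg_nonneg mult_nonneg_nonneg real_sqrt_abs real_sqrt_ge_zero zero_le_numeral)
  ultimately have c: "4 * cos t ^ 3 - 3 * cos t = 8 / (7 * sqrt 7)" by simp
  have "y ^ 3 - 21 * y = 14 * sqrt 7 * (4 * cos t ^ 3 - 3 * cos t)"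
    unfolding y_def using s7 by (simp add: power3_eq_cube algebra_simps)
  also have "\<dots> = 16" unfolding c by simp
  finally have y: "y ^ 3 - 21 * y - 16 = 0" by simp
  have "0 \<le> t" by (simp add: t_def zero_le_arctan_iff)
  moreover have "t < pi / 3"
    using arctan_ubound[of "3 * sqrt 31 / 8"] pi_gt_zero unfolding t_def by linarith
  ultimately have "cos (pi / 3) < cos t" by (intro cos_monotone_0_pi) auto
  then have y7: "sqrt 7 < y" unfolding y_def by (simp add: cos_60)
  have root: "A_quot (1 + y) = 1" using y by (simp add: A_quot_eq_1_iff)
  have ub: "x \<le> 1 + y" if "A_quot x = 1" for x
  proof (rule ccontr)
    assume "\<not> x \<le> 1 + y"
    define z where "z = x - 1"
    have zy: "y < z" using \<open>\<not> x \<le> 1 + y\<close> by (simp add: z_def)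
    have z: "z ^ 3 - 21 * z - 16 = 0" using that by (simp add: A_quot_eq_1_iff z_def)
    have y0: "0 < y" using y7 by (rule less_trans[rotated]) simp
    have "7 < y * y" using mult_strict_mono[OF y7 y7] y7 s7
      by (smt (verit) real_sqrt_ge_zero)
    moreover have "y * y < z * y" "y * y < z * z"
      using zy y0 by (auto intro!: mult_strict_mono)
    ultimately have "0 < (z - y) * (z * z + z * y + y * y - 21)"
      using zy by (intro mult_pos_pos) auto
    also have "\<dots> = (z ^ 3 - 21 * z - 16) - (y ^ 3 - 21 * y - 16)"
      by (simp add: power3_eq_cube algebra_simps)
    finally show False using y z by simp
  qed
  have r0: "r0 = 1 + y"
    unfolding r0_def using root ub by (intro Greatest_equality) auto
  show "r0 = 1 + 2 * sqrt 7 * cos (arctan (3 * sqrt 31 / 8) / 3)"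
    using r0 unfolding y_def t_def .
  show "A_quot r0 = 1" using root r0 by simp
  show "A_quot x = 1 \<Longrightarrow> x \<le> r0" using ub r0 by simp
qed

text \<open>Only the values of \<open>u\<close> on \<open>[0, \<infinity>)\<close> matter; at \<open>t = 0\<close> the derivative is one-sided.\<close>

definition cauchy_solution ::
  "(complex \<Rightarrow> complex) \<Rightarrow> complex \<Rightarrow> (real \<Rightarrow> complex) \<Rightarrow> bool" where
  "cauchy_solution f z u \<longleftrightarrow> u 0 = z \<and>
     (\<forall>t\<ge>0. u t \<in> unit_disc \<and> (u has_vector_derivative - f (u t)) (at t within {0..}))"

definition generator :: "(complex \<Rightarrow> complex) \<Rightarrow> bool" where
  "generator f \<longleftrightarrow> f holomorphic_on unit_disc \<and>
     (\<forall>z\<in>unit_disc. \<exists>u. cauchy_solution f z u \<and>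
        (\<forall>v. cauchy_solution f z v \<longrightarrow> (\<forall>t\<ge>0. v t = u t)))"

text \<open>\<open>(Id + r f)\<inverse>\<close>, with \<open>Id + r f\<close> regarded as a map on the disc. For generators every point
  of the disc has exactly one preimage in the disc, so the choice made by \<open>inv_into\<close> is forced
  there; the values outside the disc are irrelevant.\<close>

definition resolvent :: "real \<Rightarrow> (complex \<Rightarrow> complex) \<Rightarrow> complex \<Rightarrow> complex" where
  "resolvent r f = inv_into unit_disc (\<lambda>w. w + of_real r * f w)"

definition resolvent_family :: "complex \<Rightarrow> real \<Rightarrow> (complex \<Rightarrow> complex) set" where
  "resolvent_family q r = {resolvent r f | f. generator f \<and> f 0 = 0 \<and> deriv f 0 = q}"

definition starlike_quot :: "(complex \<Rightarrow> complex) \<Rightarrow> complex \<Rightarrow> complex" where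
  "starlike_quot h z = (if z = 0 then 1 else z * deriv h z / h z)"

definition normalized_on_disc :: "(complex \<Rightarrow> complex) \<Rightarrow> bool" where
  "normalized_on_disc h \<longleftrightarrow> h holomorphic_on unit_disc \<and> h 0 = 0 \<and> deriv h 0 \<noteq> 0"

text \<open>In the next two definitions a zero of \<open>h\<close> at some \<open>z \<noteq> 0\<close> is excluded automatically: the
  quotient is then \<open>0\<close> by the convention \<open>x / 0 = 0\<close>, which violates the inequality (at \<open>z = 0\<close>
  the spirallikeness inequality forces \<open>cos \<theta> > 0\<close>).\<close>

definition starlike_of_order :: "real \<Rightarrow> (complex \<Rightarrow> complex) \<Rightarrow> bool" where
  "starlike_of_order \<alpha> h \<longleftrightarrow> normalized_on_disc h \<and> 0 < \<alpha> \<and> \<alpha> < 1 \<and>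
     (\<forall>z\<in>unit_disc. Re (starlike_quot h z) > \<alpha>)"

definition spirallike_of_order :: "real \<Rightarrow> real \<Rightarrow> (complex \<Rightarrow> complex) \<Rightarrow> bool" where
  "spirallike_of_order \<theta> \<alpha> h \<longleftrightarrow> normalized_on_disc h \<and> 0 < \<alpha> \<and> \<alpha> < 1 \<and>
     (\<forall>z\<in>unit_disc. Re (exp (- (\<i> * of_real \<theta>)) * starlike_quot h z) > \<alpha> * cos \<theta>)"

text \<open>Since \<open>Arg 0 = 0\<close> in the library, a vanishing quotient (including the case \<open>h z = 0\<close>) has
  to be excluded explicitly.\<close>

definition strongly_starlike_of_order :: "real \<Rightarrow> (complex \<Rightarrow> complex) \<Rightarrow> bool" where
  "strongly_starlike_of_order \<beta> h \<longleftrightarrow> normalized_on_disc h \<and> 0 < \<beta> \<and> \<beta> < 1 \<and>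
     (\<forall>z\<in>unit_disc. starlike_quot h z \<noteq> 0 \<and> \<bar>Arg (starlike_quot h z)\<bar> < pi * \<beta> / 2)"

end

theory Submission
  imports Defs
begin

text \<open>
  Write \<open>a = r Re q\<close> and \<open>A = A(a)\<close>. The whole statement follows from the single estimate
  \<open>|1/Q - 1| < A\<close> for \<open>Q = z G'(z) / G(z)\<close>. Inversion maps the disc of radius \<open>A < 1\<close> about \<open>1\<close> to the disc with
  centre \<open>1/(1 - A\<^sup>2)\<close> and radius \<open>A/(1 - A\<^sup>2)\<close>. Its rotation by \<open>-\<theta>\<close> lies in the half-plane
  \<open>Re > (cos \<theta> - A)/(1 - A\<^sup>2)\<close>, which is spirallikeness, and for \<open>\<theta> = 0\<close> starlikeness of order \<open>1/(1 + A)\<close>; seen from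
  the origin it subtends the half-angle \<open>arcsin A\<close>, which is strong starlikeness
  (\<open>reciprocal_disc_rotated_Re\<close>, \<open>reciprocal_disc_Arg\<close>).

  For the estimate, the generator is first put into the form \<open>f(w) = w p(w)\<close> with \<open>Re p > 0\<close>. Its flow consists of
  holomorphic self-maps of the disc that fix \<open>0\<close>; by the Schwarz lemma they do not increase \<open>|w|\<close>, and
  differentiating at time \<open>0\<close> gives \<open>Re (f(w) cnj w) \<ge> 0\<close> (\<open>generator_Re_nonneg\<close>). That the flow is holomorphic in the
  initial point is derived from the linearised equation (\<open>flow_field_differentiable\<close>).

  The resolvent inverts \<open>H(w) = w (1 + r p(w))\<close>, so with \<open>w = G(z)\<close> one has
  \<open>1/Q = w H'(w)/H(w) = 1 + r w p'(w)/(1 + r p(w))\<close>. The Schwarz-Pick bound \<open>|p'(w)| \<le> 2 Re p(w)/(1 - |w|\<^sup>2)\<close> and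
  \<open>|1 + r p(w)| > r Re p(w)\<close> give \<open>|1/Q - 1| < 2|w|/(1 - |w|\<^sup>2)\<close> for \<open>w \<noteq> 0\<close>. Harnack's inequality for \<open>p\<close> shows that
  \<open>|H(w)| < 1\<close> forces \<open>|w| < 1/(a - 1)\<close>, and for such \<open>w\<close> the last bound is at most \<open>A\<close>
  (\<open>preimage_small\<close>, \<open>radius_bound_le_A_quot\<close>). Existence and uniqueness of \<open>w\<close> come from Banach's fixed
  point theorem applied to \<open>w \<mapsto> z/(1 + r p(w))\<close> (\<open>unique_preimage\<close>).
\<close>

section \<open>Flows of generators\<close>

lemma cauchy_solution_deriv_at:
  assumes "cauchy_solution f z u" "t > 0"
  shows "(u has_vector_derivative - f (u t)) (at t)"
proof -
  have "(u has_vector_derivative - f (u t)) (at t within {0<..})"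
    using assms by (intro has_vector_derivative_within_subset[of u _ t "{0..}" "{0<..}"])
      (auto simp: cauchy_solution_def)
  then show ?thesis using assms(2) at_within_open[of t "{0<..}"] by simp
qed

lemma cauchy_solution_continuous:
  assumes "cauchy_solution f z u"
  shows "continuous_on {0..s} u"
proof -
  have "continuous_on {0..} u"
    using assms unfolding cauchy_solution_def continuous_on_eq_continuous_within
    by (auto intro: has_vector_derivative_continuous)
  then show ?thesis by (rule continuous_on_subset) auto
qed

text \<open>Gronwall's inequality without square roots: \<open>|g|\<^sup>2 e\<^sup>-\<^sup>2\<^sup>L\<^sup>t\<close> has a non-positive derivative, and
  unlike \<open>|g|\<close> it is differentiable where \<open>g\<close> vanishes.\<close>

lemma gronwall_norm:
  fixes g :: "real \<Rightarrow> complex"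
  assumes "s \<ge> 0" and cont: "continuous_on {0..s} g"
    and der: "\<And>t. 0 < t \<Longrightarrow> t < s \<Longrightarrow> (g has_vector_derivative g' t) (at t)"
    and bd: "\<And>t. 0 < t \<Longrightarrow> t < s \<Longrightarrow> norm (g' t) \<le> L * norm (g t)"
  shows "norm (g s) \<le> norm (g 0) * exp (L * s)"
proof -
  define D where "D t = (g t \<bullet> g t) * exp (- 2 * L * t)" for t
  have "D s \<le> D 0"
  proof (rule DERIV_nonpos_imp_decreasing_open[OF \<open>s \<ge> 0\<close>])
    fix t assume t: "0 < t" "t < s"
    have "(D has_derivative (\<lambda>h. (g t \<bullet> (h *\<^sub>R g' t) + (h *\<^sub>R g' t) \<bullet> g t) * exp (- 2 * L * t)
            + (g t \<bullet> g t) * (exp (- 2 * L * t) * (- 2 * L * h)))) (at t)"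
      unfolding D_def using der[OF t, unfolded has_vector_derivative_def]
      by (auto intro!: derivative_eq_intros)
    then have "(D has_real_derivative (2 * (g t \<bullet> g' t) - 2 * L * (g t \<bullet> g t)) * exp (- 2 * L * t)) (at t)"
      unfolding has_field_derivative_def
      by (rule has_derivative_eq_rhs) (auto simp: algebra_simps inner_commute)
    moreover have "g t \<bullet> g' t \<le> L * (g t \<bullet> g t)"
    proof -
      have "g t \<bullet> g' t \<le> norm (g t) * norm (g' t)" by (rule norm_cauchy_schwarz)
      also have "\<dots> \<le> norm (g t) * (L * norm (g t))" using bd[OF t] by (intro mult_left_mono) auto
      finally show ?thesis by (simp add: dot_square_norm power2_eq_square mult_ac)
    qed
    then have "(2 * (g t \<bullet> g' t) - 2 * L * (g t \<bullet> g t)) * exp (- 2 * L * t) \<le> 0"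
      by (simp add: mult_nonpos_nonneg)
    ultimately show "\<exists>y. (D has_real_derivative y) (at t) \<and> y \<le> 0" by blast
  next
    show "continuous_on {0..s} D" unfolding D_def by (intro continuous_intros cont)
  qed
  then have "(norm (g s))\<^sup>2 * exp (- 2 * L * s) \<le> (norm (g 0))\<^sup>2" by (simp add: D_def dot_square_norm)
  then have "(norm (g s))\<^sup>2 * exp (- 2 * L * s) * exp (2 * L * s) \<le> (norm (g 0))\<^sup>2 * exp (2 * L * s)"
    by (intro mult_right_mono) auto
  then have "(norm (g s))\<^sup>2 \<le> (norm (g 0))\<^sup>2 * exp (2 * L * s)"
    by (simp add: mult.assoc flip: exp_add)
  also have "\<dots> = (norm (g 0) * exp (L * s))\<^sup>2"
    by (simp add: power_mult_distrib power2_eq_square flip: exp_add)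
  finally show ?thesis by (rule power2_le_imp_le) auto
qed

text \<open>The Lipschitz bound controls how far trajectories separate; the quadratic remainder is what makes
  the linearised flow a derivative.\<close>

lemma holomorphic_linear_approx:
  assumes holf: "f holomorphic_on ball 0 1" and "R < 1"
  obtains L where "L > 0"
    and "\<And>a b. \<lbrakk>a \<in> cball 0 R; b \<in> cball 0 R\<rbrakk> \<Longrightarrow> norm (f b - f a) \<le> L * norm (b - a)"
    and "\<And>a b. \<lbrakk>a \<in> cball 0 R; b \<in> cball 0 R\<rbrakk> \<Longrightarrow>
           norm (f b - f a - deriv f a * (b - a)) \<le> L * (norm (b - a))\<^sup>2"
proof -
  let ?D = "\<lambda>i. (deriv ^^ i) f"
  have sub: "cball 0 R \<subseteq> ball (0::complex) 1" using \<open>R < 1\<close> by auto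
  have hol: "?D i holomorphic_on ball 0 1" for i
    using holf by (rule holomorphic_higher_deriv) auto
  have der: "(?D i has_field_derivative ?D (Suc i) x) (at x within cball 0 R)" if "x \<in> cball 0 R" for i x
    using holomorphic_derivI[OF hol, of x i] that sub by (auto intro: has_field_derivative_at_within)
  have "\<exists>B. \<forall>x\<in>cball 0 R. norm (?D i x) \<le> B" for i
  proof -
    have "compact (?D i ` cball 0 R)"
      by (intro compact_continuous_image holomorphic_on_imp_continuous_on
            holomorphic_on_subset[OF hol sub]) auto
    then show ?thesis by (metis bounded_iff compact_imp_bounded imageI)
  qed
  then obtain B where B: "\<And>i x. x \<in> cball 0 R \<Longrightarrow> norm (?D i x) \<le> B i" by metis
  define L where "L = max 1 (max (B (Suc 0)) (B (Suc 1)))"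
  show ?thesis
  proof (rule that[of L])
    show "L > 0" by (simp add: L_def)
    fix a b :: complex assume ab: "a \<in> cball 0 R" "b \<in> cball 0 R"
    have "norm (?D 0 b - (\<Sum>i\<le>0. ?D i a * (b - a) ^ i / fact i)) \<le> B (Suc 0) * norm (b - a) ^ Suc 0 / fact 0"
      by (rule complex_Taylor[where f = ?D, OF convex_cball der B ab])
    then have "norm (f b - f a) \<le> B (Suc 0) * norm (b - a)" by simp
    also have "\<dots> \<le> L * norm (b - a)" by (intro mult_right_mono) (auto simp: L_def)
    finally show "norm (f b - f a) \<le> L * norm (b - a)" .
    have "norm (?D 0 b - (\<Sum>i\<le>1. ?D i a * (b - a) ^ i / fact i)) \<le> B (Suc 1) * norm (b - a) ^ Suc 1 / fact 1"
      by (rule complex_Taylor[where f = ?D, OF convex_cball der B ab])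
    then have "norm (f b - f a - deriv f a * (b - a)) \<le> B (Suc 1) * (norm (b - a))\<^sup>2"
      by (simp add: algebra_simps power2_eq_square)
    also have "\<dots> \<le> L * (norm (b - a))\<^sup>2" by (intro mult_right_mono) (auto simp: L_def)
    finally show "norm (f b - f a - deriv f a * (b - a)) \<le> L * (norm (b - a))\<^sup>2" .
  qed
qed

text \<open>The Lipschitz constant of \<open>f\<close> is only available on compact subdiscs, so Gronwall's inequality
  has to be combined with a continuation argument: at the first time at which the two trajectories are
  \<open>R' - R\<close> apart, the estimate valid until then shows that they are closer than that.\<close>

lemma cauchy_solutions_close:
  assumes u: "cauchy_solution f z u" and v: "cauchy_solution f w v"
    and uR: "\<And>t. t \<in> {0..T} \<Longrightarrow> norm (u t) \<le> R"
    and lip: "\<And>a b. \<lbrakk>a \<in> cball 0 R'; b \<in> cball 0 R'\<rbrakk> \<Longrightarrow> norm (f b - f a) \<le> L * norm (b - a)"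
    and "L > 0" and small: "norm (w - z) * exp (L * T) < R' - R" and t: "t \<in> {0..T}"
  shows "norm (v t - u t) \<le> norm (w - z) * exp (L * t) \<and> norm (v t) \<le> R'"
proof -
  define g where "g t = v t - u t" for t
  have g0: "g 0 = w - z" using u v by (simp add: g_def cauchy_solution_def)
  have cont: "continuous_on {0..s} g" for s
    unfolding g_def by (intro continuous_intros cauchy_solution_continuous[OF u]
        cauchy_solution_continuous[OF v])
  have RR: "R \<le> R'"
    using small by (smt (verit) exp_ge_zero mult_nonneg_nonneg norm_ge_zero)
  have vR: "norm (v s) \<le> R'" if "s \<in> {0..T}" "norm (g s) \<le> R' - R" for s
    using that uR[of s] norm_triangle_ineq[of "g s" "u s"] by (simp add: g_def)
  have est: "norm (g s) \<le> norm (w - z) * exp (L * s)"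
    if s: "s \<in> {0..T}" and le: "\<And>t. t \<in> {0..<s} \<Longrightarrow> norm (g t) \<le> R' - R" for s
  proof -
    have "norm (g s) \<le> norm (g 0) * exp (L * s)"
    proof (rule gronwall_norm)
      fix t assume t: "0 < t" "t < s"
      show "(g has_vector_derivative - f (v t) - (- f (u t))) (at t)"
        unfolding g_def using t
        by (intro has_vector_derivative_diff cauchy_solution_deriv_at[OF u] cauchy_solution_deriv_at[OF v])
      have "u t \<in> cball 0 R'" "v t \<in> cball 0 R'"
        using uR[of t] vR[of t] le[of t] t s RR by auto
      from lip[OF this]
      show "norm (- f (v t) - (- f (u t))) \<le> L * norm (g t)" by (simp add: g_def norm_minus_commute)
    qed (use s cont in auto)
    then show ?thesis by (simp add: g0)
  qed
  have lt: "norm (w - z) * exp (L * s) < R' - R" if "s \<in> {0..T}" for s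
  proof -
    have "norm (w - z) * exp (L * s) \<le> norm (w - z) * exp (L * T)"
      using that \<open>L > 0\<close> by (intro mult_left_mono) auto
    with small show ?thesis by linarith
  qed
  have below: "norm (g s) \<le> R' - R" if s: "s \<in> {0..T}" for s
  proof (rule ccontr)
    assume neg: "\<not> norm (g s) \<le> R' - R"
    define S where "S = {x \<in> {0..T}. norm (g x) \<ge> R' - R}"
    have "S = {0..T} \<inter> (\<lambda>x. norm (g x)) -` {R' - R..}" by (auto simp: S_def)
    then have "closed S"
      using continuous_closed_preimage[OF continuous_on_norm[OF cont[of T]], of "{R' - R..}"] by simp
    moreover have "bounded S" by (rule bounded_subset[of "{0..T}"]) (auto simp: S_def)
    ultimately have "compact S" by (simp add: compact_eq_bounded_closed)
    moreover have "S \<noteq> {}" using neg s by (auto simp: S_def)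
    ultimately obtain m where m: "m \<in> S" "\<And>x. x \<in> S \<Longrightarrow> m \<le> x"
      using compact_attains_inf by metis
    have "norm (g m) \<le> norm (w - z) * exp (L * m)"
    proof (rule est)
      show "norm (g x) \<le> R' - R" if "x \<in> {0..<m}" for x
        using m(2)[of x] that m(1) by (force simp: S_def)
    qed (use m in \<open>auto simp: S_def\<close>)
    with lt[of m] m(1) show False by (auto simp: S_def)
  qed
  show ?thesis using est[OF t] below vR t by (auto simp: g_def)
qed

text \<open>Holomorphic dependence on the initial point. With \<open>E t = exp (\<integral>\<^sub>0\<^sup>t f' (\<phi>\<^sub>z s) ds)\<close> as integrating
  factor of the linearised equation along the trajectory of \<open>z\<close>, the product \<open>(\<phi>\<^sub>w - \<phi>\<^sub>z) E\<close> has a derivative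
  of size \<open>O(|w - z|\<^sup>2)\<close>, so at time \<open>T\<close> it is \<open>w - z\<close> up to such an error. Hence the derivative of the
  time-\<open>T\<close> map at \<open>z\<close> is \<open>1 / E T\<close>.\<close>

lemma flow_field_differentiable:
  assumes holf: "f holomorphic_on unit_disc"
    and sol: "\<And>w. w \<in> unit_disc \<Longrightarrow> cauchy_solution f w (\<phi> w)"
    and z: "z \<in> unit_disc" and T: "T > 0"
  shows "(\<lambda>w. \<phi> w T) field_differentiable at z"
proof -
  note solz = sol[OF z]
  have contu: "continuous_on {0..T} (\<phi> z)" by (rule cauchy_solution_continuous[OF solz])
  obtain R where R: "R < 1" "\<And>t. t \<in> {0..T} \<Longrightarrow> norm (\<phi> z t) \<le> R"
  proof -
    have "\<exists>x\<in>{0..T}. \<forall>y\<in>{0..T}. norm (\<phi> z y) \<le> norm (\<phi> z x)"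
      using T by (intro continuous_attains_sup continuous_on_norm contu) auto
    then show ?thesis using that solz by (auto simp: cauchy_solution_def)
  qed
  define R' where "R' = (R + 1) / 2"
  have R': "R < R'" "R' < 1" using R(1) by (auto simp: R'_def)
  obtain L where L: "L > 0"
    and lip: "\<And>a b. \<lbrakk>a \<in> cball 0 R'; b \<in> cball 0 R'\<rbrakk> \<Longrightarrow> norm (f b - f a) \<le> L * norm (b - a)"
    and lin: "\<And>a b. \<lbrakk>a \<in> cball 0 R'; b \<in> cball 0 R'\<rbrakk> \<Longrightarrow>
           norm (f b - f a - deriv f a * (b - a)) \<le> L * (norm (b - a))\<^sup>2"
    using holomorphic_linear_approx[OF holf R'(2)] by metis
  define c where "c t = deriv f (\<phi> z t)" for t
  have contc: "continuous_on {0..T} c"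
  proof -
    have "continuous_on unit_disc (deriv f)"
      by (intro holomorphic_on_imp_continuous_on holomorphic_deriv holf) auto
    then show ?thesis unfolding c_def
      by (rule continuous_on_compose2[OF _ contu]) (use solz in \<open>auto simp: cauchy_solution_def\<close>)
  qed
  define E where "E t = exp (integral {0..t} c)" for t
  have E0: "E 0 = 1" by (simp add: E_def)
  have derI: "((\<lambda>t. integral {0..t} c) has_vector_derivative c t) (at t within {0..T})"
    if "t \<in> {0..T}" for t
    using integral_has_vector_derivative[OF contc that] .
  have contE: "continuous_on {0..T} E"
  proof -
    have "continuous_on {0..T} (\<lambda>t. integral {0..t} c)"
      unfolding continuous_on_eq_continuous_within
      using has_vector_derivative_continuous[OF derI] by blast
    then show ?thesis unfolding E_def by (rule continuous_on_exp)
  qed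
  have derE: "(E has_vector_derivative c t * E t) (at t)" if "0 < t" "t < T" for t
  proof -
    have "((\<lambda>t. integral {0..t} c) has_vector_derivative c t) (at t)"
      using derI[of t] that at_within_Icc_at[of 0 t T] by simp
    from field_vector_diff_chain_at[OF this DERIV_exp] show ?thesis
      unfolding o_def E_def .
  qed
  obtain M where M: "M > 0" "\<And>t. t \<in> {0..T} \<Longrightarrow> norm (E t) \<le> M"
    using compact_imp_bounded[OF compact_continuous_image[OF contE]] unfolding bounded_pos by auto
  define K where "K = exp (L * T)"
  define \<delta> where "\<delta> = min (1 - norm z) ((R' - R) / K)"
  have K: "K > 0" by (simp add: K_def)
  have \<delta>: "\<delta> > 0" using z R' K by (simp add: \<delta>_def)
  define C where "C = T * (L * K\<^sup>2 * M)"
  have key: "norm ((\<phi> w T - \<phi> z T) * E T - (w - z)) \<le> C * (norm (w - z))\<^sup>2"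
    if w: "norm (w - z) < \<delta>" for w
  proof -
    have wd: "w \<in> unit_disc"
      using w norm_triangle_ineq[of "w - z" z] by (simp add: \<delta>_def)
    note solw = sol[OF wd]
    have "norm (w - z) * K < R' - R" using w K by (simp add: \<delta>_def field_simps)
    then have sm: "norm (w - z) * exp (L * T) < R' - R" by (simp add: K_def)
    have close: "norm (\<phi> w t - \<phi> z t) \<le> norm (w - z) * K" "norm (\<phi> w t) \<le> R'" if "t \<in> {0..T}" for t
    proof -
      have *: "norm (\<phi> w t - \<phi> z t) \<le> norm (w - z) * exp (L * t) \<and> norm (\<phi> w t) \<le> R'"
        by (rule cauchy_solutions_close[OF solz solw R(2) lip L sm that])
      have "norm (w - z) * exp (L * t) \<le> norm (w - z) * K"
        using that L by (intro mult_left_mono) (auto simp: K_def)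
      with * show "norm (\<phi> w t - \<phi> z t) \<le> norm (w - z) * K" "norm (\<phi> w t) \<le> R'" by auto
    qed
    define k where "k t = (\<phi> w t - \<phi> z t) * E t" for t
    define k' where "k' t = (- f (\<phi> w t) - (- f (\<phi> z t))) * E t + (\<phi> w t - \<phi> z t) * (c t * E t)" for t
    have "continuous_on {0..T} k" unfolding k_def
      by (intro continuous_intros contE contu cauchy_solution_continuous[OF solw])
    moreover have "(k has_derivative (\<lambda>h. h *\<^sub>R k' t)) (at t)" if "0 < t" "t < T" for t
    proof -
      have "(k has_vector_derivative (\<phi> w t - \<phi> z t) * (c t * E t) + (- f (\<phi> w t) - (- f (\<phi> z t))) * E t) (at t)"
        unfolding k_def using that
        by (intro has_vector_derivative_mult has_vector_derivative_diff derE
            cauchy_solution_deriv_at[OF solz] cauchy_solution_deriv_at[OF solw])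
      then show ?thesis by (simp add: k'_def has_vector_derivative_def add.commute)
    qed
    ultimately obtain t where t: "t \<in> {0<..<T}" "norm (k T - k 0) \<le> norm ((T - 0) *\<^sub>R k' t)"
      using mvt_general[OF T, of k "\<lambda>t h. h *\<^sub>R k' t"] by blast
    have tT: "t \<in> {0..T}" using t by auto
    have "k' t = - ((f (\<phi> w t) - f (\<phi> z t) - c t * (\<phi> w t - \<phi> z t)) * E t)"
      by (simp add: k'_def algebra_simps)
    then have "norm (k' t) = norm (f (\<phi> w t) - f (\<phi> z t) - c t * (\<phi> w t - \<phi> z t)) * norm (E t)"
      by (simp add: norm_mult)
    also have "\<dots> \<le> (L * (norm (\<phi> w t - \<phi> z t))\<^sup>2) * M"
    proof (intro mult_mono M(2) tT)
      show "norm (f (\<phi> w t) - f (\<phi> z t) - c t * (\<phi> w t - \<phi> z t)) \<le> L * (norm (\<phi> w t - \<phi> z t))\<^sup>2"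
        unfolding c_def using close(2)[OF tT] R(2)[OF tT] R' by (intro lin) auto
    qed (use L in auto)
    also have "\<dots> \<le> (L * (norm (w - z) * K)\<^sup>2) * M"
      using L M close(1)[OF tT] by (intro mult_right_mono mult_left_mono power_mono) auto
    finally have "T * norm (k' t) \<le> C * (norm (w - z))\<^sup>2"
      using T by (simp add: C_def power_mult_distrib mult_ac)
    moreover have "k T - k 0 = (\<phi> w T - \<phi> z T) * E T - (w - z)"
      using solz solw by (simp add: k_def E0 cauchy_solution_def)
    ultimately show ?thesis using t(2) T by simp
  qed
  have ET: "E T \<noteq> 0" by (simp add: E_def)
  have "((\<lambda>w. (\<phi> w T - \<phi> z T) / (w - z)) \<longlongrightarrow> 1 / E T) (at z)"
  proof (rule Lim_null_comparison[THEN LIM_zero_cancel])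
    show "((\<lambda>w. C / norm (E T) * norm (w - z)) \<longlongrightarrow> 0) (at z)"
      by (intro tendsto_mult_right_zero tendsto_norm_zero LIM_zero tendsto_ident_at)
    show "\<forall>\<^sub>F w in at z. norm ((\<phi> w T - \<phi> z T) / (w - z) - 1 / E T) \<le> C / norm (E T) * norm (w - z)"
      unfolding eventually_at
    proof (intro exI[of _ \<delta>] conjI ballI impI \<delta>)
      fix w assume w: "w \<noteq> z \<and> dist w z < \<delta>"
      have "norm ((\<phi> w T - \<phi> z T) / (w - z) - 1 / E T)
          = norm ((\<phi> w T - \<phi> z T) * E T - (w - z)) / (norm (w - z) * norm (E T))"
        using w ET by (simp add: diff_frac_eq norm_divide norm_mult)
      also have "\<dots> \<le> C * (norm (w - z))\<^sup>2 / (norm (w - z) * norm (E T))"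
        using key[of w] w by (intro divide_right_mono) (auto simp: dist_norm)
      also have "\<dots> = C / norm (E T) * norm (w - z)"
        using w by (simp add: power2_eq_square)
      finally show "norm ((\<phi> w T - \<phi> z T) / (w - z) - 1 / E T) \<le> C / norm (E T) * norm (w - z)" .
    qed
  qed
  then show ?thesis
    unfolding field_differentiable_def has_field_derivative_iff by blast
qed

text \<open>The Berkson-Porta condition at the fixed point \<open>0\<close>: the time-\<open>t\<close> maps of the flow are holomorphic
  self-maps of the disc fixing \<open>0\<close>, so by the Schwarz lemma they do not increase the modulus. Hence
  the derivative of \<open>|\<phi> z t|\<^sup>2\<close> at \<open>t = 0\<close>, which is \<open>- 2 Re (f z * cnj z)\<close>, is not positive.\<close>

theorem generator_Re_nonneg:
  assumes gen: "generator f" and f0: "f 0 = 0" and z: "z \<in> unit_disc"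
  shows "Re (f z * cnj z) \<ge> 0"
proof -
  have holf: "f holomorphic_on unit_disc" using gen by (simp add: generator_def)
  obtain \<phi> where sol: "\<And>w. w \<in> unit_disc \<Longrightarrow> cauchy_solution f w (\<phi> w)"
    and uniq: "\<And>w v t. \<lbrakk>w \<in> unit_disc; cauchy_solution f w v; t \<ge> 0\<rbrakk> \<Longrightarrow> v t = \<phi> w t"
    using gen unfolding generator_def by metis
  have decr: "norm (\<phi> z t) \<le> norm z" if t: "t > 0" for t
  proof (rule Schwarz_Lemma(1))
    show "(\<lambda>w. \<phi> w t) holomorphic_on ball 0 1"
      using flow_field_differentiable[OF holf sol _ t]
      by (auto simp: holomorphic_on_def intro: field_differentiable_at_within)
    have "cauchy_solution f 0 (\<lambda>t. 0)" by (simp add: cauchy_solution_def f0)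
    from uniq[OF _ this, of t] t show "\<phi> 0 t = 0" by simp
    show "norm (\<phi> w t) < 1" if "norm w < 1" for w
      using sol[of w] that t by (simp add: cauchy_solution_def)
  qed (use z in auto)
  define N where "N t = \<phi> z t \<bullet> \<phi> z t" for t
  have \<phi>0: "\<phi> z 0 = z" using sol[OF z] by (simp add: cauchy_solution_def)
  have "(\<phi> z has_derivative (\<lambda>h. h *\<^sub>R (- f z))) (at 0 within {0..})"
    using sol[OF z] unfolding cauchy_solution_def has_vector_derivative_def by force
  then have "(N has_derivative (\<lambda>h. z \<bullet> (h *\<^sub>R (- f z)) + (h *\<^sub>R (- f z)) \<bullet> z)) (at 0 within {0..})"
    unfolding N_def by (auto intro!: derivative_eq_intros simp: \<phi>0)
  then have "(N has_real_derivative (- 2 * (f z \<bullet> z))) (at 0 within {0..})"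
    unfolding has_field_derivative_def
    by (rule has_derivative_eq_rhs) (auto simp: inner_commute)
  then have lim: "((\<lambda>t. (N t - N 0) / (t - 0)) \<longlongrightarrow> - 2 * (f z \<bullet> z)) (at 0 within {0..})"
    by (simp add: has_field_derivative_iff)
  have "- 2 * (f z \<bullet> z) \<le> 0"
  proof (rule tendsto_upperbound[OF lim])
    show "\<forall>\<^sub>F t in at 0 within {0..}. (N t - N 0) / (t - 0) \<le> 0"
      unfolding eventually_at
    proof (intro exI[of _ 1] conjI ballI impI)
      fix t :: real assume t: "t \<in> {0..}" "t \<noteq> 0 \<and> dist t 0 < 1"
      then have "N t \<le> N 0"
        using decr[of t] by (simp add: N_def \<phi>0 dot_square_norm power_mono)
      then show "(N t - N 0) / (t - 0) \<le> 0" using t by (simp add: divide_nonpos_pos)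
    qed auto
    show "at (0::real) within {0..} \<noteq> bot"
      using trivial_limit_at_right_real[of "0::real"]
      by (metis at_within_Ici_at_right)
  qed
  then have "0 \<le> f z \<bullet> z" by linarith
  then show ?thesis by (simp add: inner_complex_def)
qed

section \<open>Holomorphic functions with positive real part\<close>

text \<open>Both estimates are the Schwarz lemma for the Cayley transform \<open>m\<close> of \<open>p\<close> that sends \<open>p 0\<close> to \<open>0\<close>:
  the first is \<open>|m' 0| \<le> 1\<close>, the second is \<open>|m w| \<le> |w|\<close> solved for \<open>Re (p w)\<close>.\<close>

lemma half_plane_Schwarz:
  assumes holp: "p holomorphic_on ball 0 1"
    and pos: "\<And>w. norm w < 1 \<Longrightarrow> Re (p w) > 0"
  shows half_plane_deriv_zero: "norm (deriv p 0) \<le> 2 * Re (p 0)"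
    and half_plane_Harnack: "norm w < 1 \<Longrightarrow> Re (p w) \<ge> Re (p 0) * (1 - norm w) / (1 + norm w)"
proof -
  define m where "m w = (p w - p 0) / (p w + cnj (p 0))" for w
  have p0: "Re (p 0) > 0" by (simp add: pos)
  have nz: "p w + cnj (p 0) \<noteq> 0" if "norm w < 1" for w
    using pos[OF that] p0 by (auto simp: complex_eq_iff)
  have holm: "m holomorphic_on ball 0 1"
    unfolding m_def using nz by (intro holomorphic_intros holp) auto
  have m0: "m 0 = 0" by (simp add: m_def)
  have mlt: "norm (m w) < 1" if w: "norm w < 1" for w
  proof -
    have "(norm (p w + cnj (p 0)))\<^sup>2 - (norm (p w - p 0))\<^sup>2 = 4 * Re (p w) * Re (p 0)"
      by (simp only: cmod_power2 minus_complex.simps plus_complex.simps complex_cnj) (simp add: power2_eq_square algebra_simps)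
    also have "\<dots> > 0" using pos[OF w] p0 by simp
    finally have "norm (p w - p 0) < norm (p w + cnj (p 0))"
      using power2_less_imp_less[of "norm (p w - p 0)"] by simp
    then show ?thesis using nz[OF w] by (simp add: m_def norm_divide)
  qed
  show "norm (deriv p 0) \<le> 2 * Re (p 0)"
  proof -
    have dp: "(p has_field_derivative deriv p 0) (at 0)"
      by (rule holomorphic_derivI[OF holp]) auto
    have s: "p 0 + cnj (p 0) = of_real (2 * Re (p 0))" by (simp add: complex_add_cnj)
    have "(m has_field_derivative deriv p 0 / (p 0 + cnj (p 0))) (at 0)"
      unfolding m_def using nz[of 0] dp
      by (auto intro!: derivative_eq_intros)
    then have "deriv m 0 = deriv p 0 / of_real (2 * Re (p 0))"
      using DERIV_imp_deriv s by metis
    then have "norm (deriv m 0) = norm (deriv p 0) / (2 * Re (p 0))"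
      using p0 by (simp add: norm_divide norm_mult)
    moreover have "norm (deriv m 0) \<le> 1" by (rule Schwarz_Lemma(2)[OF holm m0 mlt, of 0]) auto
    ultimately show ?thesis using p0 by (simp add: divide_le_eq)
  qed
  show "Re (p w) \<ge> Re (p 0) * (1 - norm w) / (1 + norm w)" if w: "norm w < 1"
  proof -
    have mw: "norm (m w) \<le> norm w" by (rule Schwarz_Lemma(1)[OF holm m0 mlt w])
    have m1: "1 - m w \<noteq> 0" using mlt[OF w] by auto
    have "m w * (p w + cnj (p 0)) = p w - p 0" using nz[OF w] by (simp add: m_def)
    then have "p w * (1 - m w) = p 0 + cnj (p 0) * m w" by (simp add: algebra_simps)
    then have "p w * (1 - m w) * cnj (1 - m w) = (p 0 + cnj (p 0) * m w) * cnj (1 - m w)" by simp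
    then have "p w * of_real ((norm (1 - m w))\<^sup>2) = (p 0 + cnj (p 0) * m w) * (1 - cnj (m w))"
      by (simp add: mult.assoc complex_norm_square del: of_real_power)
    then have "Re (p w * of_real ((norm (1 - m w))\<^sup>2)) = Re ((p 0 + cnj (p 0) * m w) * (1 - cnj (m w)))"
      by (rule arg_cong)
    then have eq: "Re (p w) * (norm (1 - m w))\<^sup>2 = Re (p 0) * (1 - (norm (m w))\<^sup>2)"
      unfolding cmod_power2 by (simp add: algebra_simps power2_eq_square)
    have "norm (1 - m w) \<le> 1 + norm (m w)" using norm_triangle_ineq4[of 1 "m w"] by simp
    then have "(norm (1 - m w))\<^sup>2 \<le> (1 + norm (m w))\<^sup>2" by (rule power_mono) auto
    then have "Re (p 0) * (1 - (norm (m w))\<^sup>2) \<le> Re (p w) * (1 + norm (m w))\<^sup>2"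
      using pos[OF w] by (subst eq[symmetric]) (intro mult_left_mono, auto)
    then have "(1 + norm (m w)) * (Re (p 0) * (1 - norm (m w))) \<le> (1 + norm (m w)) * (Re (p w) * (1 + norm (m w)))"
      by (simp add: power2_eq_square algebra_simps)
    then have "Re (p 0) * (1 - norm (m w)) \<le> Re (p w) * (1 + norm (m w))"
      by (subst (asm) mult_le_cancel_left_pos) (auto simp: add_pos_nonneg)
    moreover have "Re (p 0) * (1 - norm w) \<le> Re (p 0) * (1 - norm (m w))"
      using mw p0 by (intro mult_left_mono) auto
    moreover have "Re (p w) * (1 + norm (m w)) \<le> Re (p w) * (1 + norm w)"
      using mw pos[OF w] by (intro mult_left_mono) auto
    ultimately have "Re (p 0) * (1 - norm w) \<le> Re (p w) * (1 + norm w)" by linarith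
    then show ?thesis by (simp add: divide_le_eq add_pos_nonneg)
  qed
qed

text \<open>The estimate at the origin, transported to \<open>w\<close> by the disc automorphism \<open>M\<close> that sends \<open>0\<close> to \<open>w\<close>;
  \<open>M' 0 = 1 - |w|\<^sup>2\<close>.\<close>

lemma half_plane_deriv:
  assumes holp: "p holomorphic_on ball 0 1"
    and pos: "\<And>w. norm w < 1 \<Longrightarrow> Re (p w) > 0" and w: "norm w < 1"
  shows "norm (deriv p w) * (1 - (norm w)\<^sup>2) \<le> 2 * Re (p w)"
proof -
  define M where "M = Moebius_function 0 (- w)"
  have Meq: "M = (\<lambda>z. (z + w) / (1 + cnj w * z))" by (simp add: M_def Moebius_function_def fun_eq_iff)
  have lt: "norm (M z) < 1" if "norm z < 1" for z
    unfolding M_def by (rule Moebius_function_norm_lt_1) (use that w in auto)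
  have holM: "M holomorphic_on ball 0 1"
    unfolding M_def by (rule Moebius_function_holomorphic) (use w in auto)
  have M0: "M 0 = w" by (simp add: Meq)
  have "(p \<circ> M) holomorphic_on ball 0 1"
    using lt by (intro holomorphic_on_compose_gen[OF holM holp]) auto
  then have "norm (deriv (p \<circ> M) 0) \<le> 2 * Re ((p \<circ> M) 0)"
    by (rule half_plane_deriv_zero) (use pos lt in auto)
  moreover have "(M has_field_derivative of_real (1 - (norm w)\<^sup>2)) (at 0)"
    unfolding Meq by (auto intro!: derivative_eq_intros simp: complex_norm_square simp del: of_real_power)
  then have "(p \<circ> M has_field_derivative deriv p w * of_real (1 - (norm w)\<^sup>2)) (at 0)"
    by (intro DERIV_chain) (use holomorphic_derivI[OF holp _, of w] w in \<open>auto simp: M0\<close>)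
  then have "deriv (p \<circ> M) 0 = deriv p w * of_real (1 - (norm w)\<^sup>2)" by (rule DERIV_imp_deriv)
  moreover have "(norm w)\<^sup>2 \<le> 1" using w by (simp add: power_le_one)
  ultimately show ?thesis by (simp add: M0 norm_mult del: of_real_diff)
qed

text \<open>An open set of values contained in the closed half-plane lies in the open one.\<close>

lemma Re_pos_of_nonneg:
  assumes holp: "p holomorphic_on ball 0 1"
    and nn: "\<And>w. norm w < 1 \<Longrightarrow> Re (p w) \<ge> 0" and p0: "Re (p 0) > 0" and w: "norm w < 1"
  shows "Re (p w) > 0"
proof (cases "p constant_on ball 0 1")
  case True
  then have "p w = p 0" using w by (auto simp: constant_on_def)
  then show ?thesis using p0 by simp
next
  case False
  have "open (p ` ball 0 1)"
    by (rule open_mapping_thm[OF holp _ _ _ subset_refl False]) auto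
  moreover have "p w \<in> p ` ball 0 1" using w by auto
  ultimately obtain e where e: "e > 0" "ball (p w) e \<subseteq> p ` ball 0 1"
    by (meson open_contains_ball)
  have "p w - of_real (e/2) \<in> ball (p w) e" using e(1) by (simp add: dist_norm)
  then have "p w - of_real (e/2) \<in> p ` ball 0 1" using e(2) by blast
  then obtain v where "norm v < 1" "p v = p w - of_real (e/2)" by auto
  then have "0 \<le> Re (p w) - e/2" using nn[of v] by (metis Re_complex_of_real minus_complex.simps(1))
  then show ?thesis using e(1) by linarith
qed

theorem generator_eq_id_times:
  assumes nn: "\<And>z. z \<in> unit_disc \<Longrightarrow> Re (f z * cnj z) \<ge> 0"
    and holf: "f holomorphic_on unit_disc" and f0: "f 0 = 0" and q: "Re (deriv f 0) > 0"
  obtains p where "p holomorphic_on unit_disc" "\<And>z. norm z < 1 \<Longrightarrow> f z = z * p z"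
    "p 0 = deriv f 0" "\<And>z. norm z < 1 \<Longrightarrow> Re (p z) > 0"
proof -
  obtain p where p: "p holomorphic_on ball 0 1" "\<And>z. norm z < 1 \<Longrightarrow> f z = z * p z" "deriv f 0 = p 0"
    using Schwarz3[OF holf f0] by metis
  have "Re (p z) \<ge> 0" if z: "norm z < 1" for z
  proof (cases "z = 0")
    case True then show ?thesis using q p(3) by simp
  next
    case False
    have "f z * cnj z = p z * of_real ((norm z)\<^sup>2)"
      using p(2)[OF z] by (simp add: complex_norm_square mult_ac del: of_real_power)
    then have "Re (f z * cnj z) = Re (p z) * (norm z)\<^sup>2" by simp
    then show ?thesis using nn[of z] z False by (simp add: zero_le_mult_iff)
  qed
  then have "Re (p z) > 0" if "norm z < 1" for z
    using Re_pos_of_nonneg[OF p(1)] q p(3) that by simp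
  with p show ?thesis by (intro that[of p]) auto
qed

section \<open>The function A\<close>

text \<open>The factor \<open>x - 2\<close> of the denominator cancels in the comparison with the radius estimate below.\<close>

lemma A_quot_factored:
  "A_quot x = 6 * x * (1 + x) / ((x - 2) * (x\<^sup>2 + 5 * x - 2))"
  by (simp add: A_quot_def power3_eq_cube power2_eq_square algebra_simps)

lemma five_less_r0: "5 < r0"
proof -
  have "\<exists>x\<ge>5. x \<le> 6 \<and> (x - 1) ^ 3 - 21 * (x - 1) - 16 = (0::real)"
    by (rule IVT') (auto intro!: continuous_intros)
  then obtain x where x: "5 \<le> x" "(x - 1) ^ 3 - 21 * (x - 1) - 16 = (0::real)" by blast
  moreover have "x \<noteq> 5" using x(2) by auto
  ultimately show ?thesis using r0_largest[of x] by (simp add: A_quot_eq_1_iff)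
qed

lemma A_quot_denominator_pos:
  fixes a :: real
  assumes "a > 2"
  shows "(a - 2) * (a\<^sup>2 + 5 * a - 2) > 0"
proof -
  have "a\<^sup>2 > 0" using assms by simp
  then have "a\<^sup>2 + 5 * a - 2 > 0" using assms by linarith
  then show ?thesis using assms by simp
qed

lemma A_quot_pos: "a > 2 \<Longrightarrow> 0 < A_quot a"
  unfolding A_quot_factored using A_quot_denominator_pos[of a] by simp

text \<open>Clearing the denominator, \<open>A x < 1\<close> says that the cubic defining \<open>r0\<close> is positive at \<open>x\<close>. It cannot be
  non-positive beyond \<open>r0\<close>, because it is positive further out and would have another root in between.\<close>

lemma A_quot_less_1:
  assumes "a > r0"
  shows "A_quot a < 1"
proof -
  have a5: "a > 5" using five_less_r0 assms by linarith
  then have den: "(a - 2) * (a\<^sup>2 + 5 * a - 2) > 0" by (intro A_quot_denominator_pos) auto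
  have "(a - 1) ^ 3 - 21 * (a - 1) - 16 > 0"
  proof (rule ccontr)
    assume neg: "\<not> ?thesis"
    have "((a + 10) - 1) ^ 3 - 21 * ((a + 10) - 1) - 16 \<ge> 0"
    proof -
      have "21 * (a + 9) + 16 \<le> (a + 9) * ((a + 9) * (a + 9))"
      proof -
        have "14 * 14 \<le> (a + 9) * (a + 9)" using a5 by (intro mult_mono) auto
        then have "(a + 9) * 196 \<le> (a + 9) * ((a + 9) * (a + 9))" using a5 by (intro mult_left_mono) auto
        moreover have "21 * (a + 9) + 16 \<le> (a + 9) * 196" using a5 by simp
        ultimately show ?thesis by (rule order_trans[rotated])
      qed
      then show ?thesis by (simp add: power3_eq_cube algebra_simps)
    qed
    then have "\<exists>x\<ge>a. x \<le> a + 10 \<and> (x - 1) ^ 3 - 21 * (x - 1) - 16 = (0::real)"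
      using neg by (intro IVT') (auto intro!: continuous_intros)
    then show False using r0_largest assms by (force simp: A_quot_eq_1_iff)
  qed
  moreover have "(a - 2) * (a\<^sup>2 + 5 * a - 2) - 6 * a * (1 + a) = (a - 1) ^ 3 - 21 * (a - 1) - 16"
    by (simp add: power3_eq_cube power2_eq_square algebra_simps)
  ultimately show "A_quot a < 1"
    unfolding A_quot_factored using den by (simp add: divide_less_eq)
qed

lemma A_quot_less_6_over:
  assumes "a \<ge> 6"
  shows "A_quot a < 6 / a"
proof -
  have den: "(a - 2) * (a\<^sup>2 + 5 * a - 2) > 0" using assms by (intro A_quot_denominator_pos) auto
  have "0 \<le> a * (a - 6)" using assms by simp
  then have "a * a * (1 + a) < (a - 2) * (a\<^sup>2 + 5 * a - 2)"
    by (simp add: power2_eq_square algebra_simps)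
  then show ?thesis
    unfolding A_quot_factored using den assms by (simp add: divide_less_eq less_divide_eq field_simps)
qed

text \<open>The left-hand side increases with \<open>\<rho>\<close>, and at \<open>\<rho> = 1 / (a - 1)\<close> it equals
  \<open>2 (a - 1) / (a (a - 2))\<close>; comparing with \<open>A\<close> is then a polynomial inequality.\<close>

lemma radius_bound_le_A_quot:
  assumes a: "a > 5" and \<rho>: "0 \<le> \<rho>" "\<rho> < 1 / (a - 1)"
  shows "2 * \<rho> / (1 - \<rho>\<^sup>2) \<le> A_quot a"
proof -
  have sq: "\<rho>\<^sup>2 \<le> (1 / (a - 1))\<^sup>2" using \<rho> by (intro power_mono) auto
  have "1 / (a - 1) < 1" using a by simp
  then have lt1: "(1 / (a - 1))\<^sup>2 < 1" using a by (simp add: power_less_one_iff)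
  have "2 * \<rho> / (1 - \<rho>\<^sup>2) \<le> 2 * (1 / (a - 1)) / (1 - (1 / (a - 1))\<^sup>2)"
    using \<rho> sq lt1 a by (intro frac_le) auto
  also have "\<dots> = 2 * (a - 1) / (a * (a - 2))"
  proof -
    have "1 - (1 / (a - 1))\<^sup>2 = ((a - 1)\<^sup>2 - 1) / (a - 1)\<^sup>2"
      using a by (simp add: power_divide diff_divide_distrib)
    also have "(a - 1)\<^sup>2 - 1 = a * (a - 2)" by (simp add: power2_eq_square algebra_simps)
    finally have "1 - (1 / (a - 1))\<^sup>2 = a * (a - 2) / (a - 1)\<^sup>2" .
    then show ?thesis using a by (simp add: power2_eq_square)
  qed
  also have "\<dots> \<le> A_quot a"
  proof -
    have "a\<^sup>2 > 0" using a by simp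
    then have d: "a\<^sup>2 + 5 * a - 2 > 0" using a by linarith
    have "0 \<le> a * a * (4 * a - 2)" using a by (intro mult_nonneg_nonneg) auto
    moreover have "6 * a * (1 + a) * a - 2 * (a - 1) * (a\<^sup>2 + 5 * a - 2) = a * a * (4 * a - 2) + (14 * a - 4)"
      by (simp add: power2_eq_square algebra_simps)
    ultimately have "2 * (a - 1) * (a\<^sup>2 + 5 * a - 2) \<le> 6 * a * (1 + a) * a"
      using a by linarith
    then have "2 * (a - 1) / a \<le> 6 * a * (1 + a) / (a\<^sup>2 + 5 * a - 2)"
      using d a by (simp add: frac_le_eq divide_le_0_iff field_simps)
    then have "2 * (a - 1) / a / (a - 2) \<le> 6 * a * (1 + a) / (a\<^sup>2 + 5 * a - 2) / (a - 2)"
      using a by (intro divide_right_mono) auto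
    then show ?thesis unfolding A_quot_factored by (simp add: mult.commute)
  qed
  finally show ?thesis .
qed

section \<open>Discs around 1 under inversion\<close>

text \<open>The inequality is \<open>|1 - Q| < A |Q|\<close> squared. Completing the square, it describes the disc with centre
  \<open>1 / (1 - A\<^sup>2)\<close> and radius \<open>A / (1 - A\<^sup>2)\<close>, the image of the disc of radius \<open>A\<close> about \<open>1\<close> under inversion.\<close>

lemma reciprocal_disc:
  assumes A: "0 < A" "A < 1" and Q: "Q \<noteq> 0" and near: "norm (1 / Q - 1) < A"
  shows "(1 - A\<^sup>2) * (norm Q)\<^sup>2 + 1 < 2 * Re Q"
proof -
  have "norm (1 - Q) = norm (1 / Q - 1) * norm Q"
    using Q by (simp flip: norm_mult add: left_diff_distrib)
  also have "\<dots> < A * norm Q" using near Q by simp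
  finally have "(norm (1 - Q))\<^sup>2 < (A * norm Q)\<^sup>2" using A by (intro power_strict_mono) auto
  moreover have "(norm (1 - Q))\<^sup>2 = (norm Q)\<^sup>2 - 2 * Re Q + 1"
    unfolding cmod_power2 by (simp add: power2_eq_square algebra_simps)
  ultimately show ?thesis by (simp add: power_mult_distrib algebra_simps)
qed

text \<open>After rotation by \<open>- \<theta>\<close> the centre \<open>c = 1 / (1 - A\<^sup>2)\<close> of the image disc has real part \<open>c cos \<theta>\<close>, and
  the radius \<open>A c\<close> is subtracted from it.\<close>

lemma reciprocal_disc_rotated_Re:
  assumes A: "0 < A" "A < 1" and Q: "Q \<noteq> 0" and near: "norm (1 / Q - 1) < A"
  shows "Re (exp (- (\<i> * of_real \<theta>)) * Q) > (cos \<theta> - A) / (1 - A\<^sup>2)"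
proof -
  define c where "c = 1 / (1 - A\<^sup>2)"
  have A2: "1 - A\<^sup>2 > 0" using A by (simp add: power_less_one_iff)
  have c: "c > 0" "(1 - A\<^sup>2) * c = 1" using A2 by (auto simp: c_def)
  have eq: "(norm (Q - of_real c))\<^sup>2 = (norm Q)\<^sup>2 - 2 * c * Re Q + c\<^sup>2"
    unfolding cmod_power2 by (simp add: power2_eq_square algebra_simps)
  have "c * ((1 - A\<^sup>2) * (norm Q)\<^sup>2 + 1) < c * (2 * Re Q)"
    using reciprocal_disc[OF assms] c(1) by simp
  moreover have "c * ((1 - A\<^sup>2) * (norm Q)\<^sup>2 + 1) = ((1 - A\<^sup>2) * c) * (norm Q)\<^sup>2 + c"
    by (simp add: algebra_simps)
  ultimately have "(norm (Q - of_real c))\<^sup>2 < c\<^sup>2 - c"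
    unfolding eq c(2) by simp
  also have "c\<^sup>2 - c = (A * c)\<^sup>2"
  proof -
    have "c\<^sup>2 - c = c * (c - (1 - A\<^sup>2) * c)" unfolding c(2) by (simp add: power2_eq_square algebra_simps)
    then show ?thesis by (simp add: power2_eq_square algebra_simps)
  qed
  finally have d: "norm (Q - of_real c) < A * c"
    by (rule power2_less_imp_less) (use A c in auto)
  have "\<bar>Re (exp (- (\<i> * of_real \<theta>)) * (Q - of_real c))\<bar> \<le> norm (exp (- (\<i> * of_real \<theta>)) * (Q - of_real c))"
    by (rule abs_Re_le_cmod)
  also have "\<dots> = norm (Q - of_real c)" by (simp add: norm_mult)
  finally have "Re (exp (- (\<i> * of_real \<theta>)) * (Q - of_real c)) > - (A * c)" using d by linarith
  moreover have "Re (exp (- (\<i> * of_real \<theta>)) * of_real c) = c * cos \<theta>"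
    by (simp add: Re_exp)
  moreover have "Re (exp (- (\<i> * of_real \<theta>)) * Q) =
      Re (exp (- (\<i> * of_real \<theta>)) * (Q - of_real c)) + Re (exp (- (\<i> * of_real \<theta>)) * of_real c)"
    by (simp only: right_diff_distrib minus_complex.simps)
  ultimately have "Re (exp (- (\<i> * of_real \<theta>)) * Q) > c * cos \<theta> - A * c" by linarith
  then show ?thesis by (simp add: c_def diff_divide_distrib)
qed

text \<open>The image disc is seen from the origin under the half-angle \<open>arcsin A\<close>. The arithmetic-geometric
  mean inequality turns the description of the disc into \<open>Re Q > sqrt (1 - A\<^sup>2) |Q|\<close>, which compares the
  cosines of the two angles.\<close>

lemma reciprocal_disc_Arg:
  assumes A: "0 < A" "A < 1" and Q: "Q \<noteq> 0" and near: "norm (1 / Q - 1) < A"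
  shows "\<bar>Arg Q\<bar> < arcsin A"
proof -
  have A2: "1 - A\<^sup>2 > 0" using A by (simp add: power_less_one_iff)
  define s where "s = sqrt (1 - A\<^sup>2)"
  have s: "s > 0" "s\<^sup>2 = 1 - A\<^sup>2" using A2 by (auto simp: s_def)
  have "0 \<le> (s * norm Q - 1)\<^sup>2" by simp
  then have "2 * (s * norm Q) \<le> (1 - A\<^sup>2) * (norm Q)\<^sup>2 + 1"
    by (simp add: power2_diff power_mult_distrib s(2))
  then have "s * norm Q < Re Q" using reciprocal_disc[OF assms] by linarith
  moreover have "Re Q = norm Q * cos (Arg Q)" by (simp add: Q cos_Arg)
  ultimately have "s < cos \<bar>Arg Q\<bar>" using Q by (simp add: mult.commute)
  then have "cos (arcsin A) < cos \<bar>Arg Q\<bar>" using A by (simp add: s_def cos_arcsin)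
  moreover have "0 \<le> arcsin A" "arcsin A \<le> pi"
    using A arcsin_bounded[of A] arcsin_le_arcsin[of 0 A] pi_gt_zero by auto
  moreover have "\<bar>Arg Q\<bar> \<le> pi" using Arg_bounded[of Q] by auto
  ultimately show ?thesis by (subst (asm) cos_mono_less_eq) auto
qed

section \<open>The resolvent as the inverse of \<open>w (1 + r p w)\<close>\<close>

text \<open>The setting after the generator is written as \<open>f w = w p w\<close>. Any bound on \<open>a\<close> between \<open>5\<close> and \<open>r0\<close>
  would do: from \<open>5\<close> on the contraction below works on the disc of radius \<open>1/4\<close>.\<close>

locale half_plane_resolvent =
  fixes p :: "complex \<Rightarrow> complex" and r a :: real
  assumes holp: "p holomorphic_on unit_disc"
    and Rep: "norm w < 1 \<Longrightarrow> Re (p w) > 0"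
    and r: "r > 0" and a_eq: "a = r * Re (p 0)" and a5: "a > 5"
begin

text \<open>The map \<open>Id + r f\<close> whose inverse is the resolvent.\<close>

definition H :: "complex \<Rightarrow> complex" where
  "H w = w * (1 + of_real r * p w)"

lemma norm_factor_ge: "norm (1 + of_real r * p w) \<ge> 1 + r * Re (p w)"
  using complex_Re_le_cmod[of "1 + of_real r * p w"] by simp

lemma norm_factor_ge_Harnack:
  assumes w: "norm w < 1"
  shows "norm (1 + of_real r * p w) \<ge> 1 + a * (1 - norm w) / (1 + norm w)"
proof -
  have "r * (Re (p 0) * (1 - norm w) / (1 + norm w)) \<le> r * Re (p w)"
    using half_plane_Harnack[OF holp Rep w] r by (intro mult_left_mono) auto
  then show ?thesis using norm_factor_ge[of w] by (simp add: a_eq)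
qed

lemma factor_nonzero:
  assumes w: "norm w < 1"
  shows "1 + of_real r * p w \<noteq> 0"
proof
  assume "1 + of_real r * p w = 0"
  then have "norm (1 + of_real r * p w) = 0" by (simp only: norm_zero)
  then show False using norm_factor_ge[of w] Rep[OF w] r by (smt (verit) mult_pos_pos)
qed

lemma deriv_factor_bound:
  assumes w: "norm w < 1"
  shows "r * norm (deriv p w) \<le> 2 / (1 - (norm w)\<^sup>2) * (r * Re (p w))"
proof -
  have "1 - (norm w)\<^sup>2 > 0" using w by (simp add: power_less_one_iff)
  then have "norm (deriv p w) \<le> 2 * Re (p w) / (1 - (norm w)\<^sup>2)"
    using half_plane_deriv[OF holp Rep w] by (simp add: field_simps)
  then have "r * norm (deriv p w) \<le> r * (2 * Re (p w) / (1 - (norm w)\<^sup>2))"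
    using r by (intro mult_left_mono) auto
  then show ?thesis by (simp add: mult_ac)
qed

text \<open>By Harnack's inequality \<open>|H w| \<ge> x (1 + a (1 - x) / (1 + x))\<close> with \<open>x = |w|\<close>. The right-hand side takes the
  value \<open>1\<close> at \<open>x = 1 / (a - 1)\<close> and at \<open>x = 1\<close>, and exceeds \<open>1\<close> in between, so the points that \<open>H\<close>
  maps into the disc are confined to the smaller disc.\<close>

lemma preimage_small:
  assumes w: "norm w < 1" and Hw: "norm (H w) < 1"
  shows "norm w < 1 / (a - 1)"
proof -
  define x where "x = norm w"
  have x: "0 \<le> x" "x < 1" using w by (auto simp: x_def)
  have "x * (1 + a * (1 - x) / (1 + x)) \<le> norm (H w)"
    unfolding H_def norm_mult x_def using norm_factor_ge_Harnack[OF w] by (intro mult_left_mono) auto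
  then have "x * (1 + a * (1 - x) / (1 + x)) < 1" using Hw by linarith
  moreover have "1 - x * (1 + a * (1 - x) / (1 + x)) = (1 - x) * (1 - (a - 1) * x) / (1 + x)"
    using x by (simp add: field_simps)
  ultimately have "(1 - x) * (1 - (a - 1) * x) / (1 + x) > 0" by linarith
  then have "1 - (a - 1) * x > 0" using x by (simp add: zero_less_divide_iff zero_less_mult_iff)
  then show ?thesis using a5 by (simp add: x_def field_simps)
qed

lemma preimage_quarter:
  assumes "norm w < 1" "norm (H w) < 1"
  shows "norm w < 1 / 4"
proof -
  have "1 / (a - 1) < 1 / 4" using a5 by (intro divide_strict_left_mono) auto
  then show ?thesis using preimage_small[OF assms] by linarith
qed

text \<open>The equation \<open>H w = z\<close> says that \<open>w\<close> is a fixed point of \<open>T w = z / (1 + r p w)\<close>. On the disc of radius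
  \<open>1/4\<close>, where all solutions lie, \<open>T\<close> is a contraction: \<open>|p'|\<close> is at most \<open>2 Re p / (1 - 1/16)\<close>, and
  \<open>s / (1 + s)\<^sup>2 \<le> 1/4\<close> for \<open>s = r Re p\<close>, which gives the constant \<open>8/15\<close>.\<close>

lemma unique_preimage:
  assumes z: "norm z < 1"
  shows "\<exists>!w. norm w < 1 \<and> H w = z"
proof -
  define T where "T w = z / (1 + of_real r * p w)" for w
  have lt1: "norm w < 1" if "w \<in> cball 0 (1/4)" for w :: complex using that by simp
  have fixed_iff: "T w = w \<longleftrightarrow> H w = z" if "norm w < 1" for w
    using factor_nonzero[OF that] by (auto simp: T_def H_def field_simps)
  have "\<exists>!w. w \<in> cball 0 (1/4) \<and> T w = w"
  proof (rule Banach_fix)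
    show "complete (cball (0::complex) (1/4))" by (simp add: complete_eq_closed)
    show "T ` cball 0 (1/4) \<subseteq> cball 0 (1/4)"
    proof safe
      fix w :: complex assume w: "w \<in> cball 0 (1/4)"
      have "3 / 5 \<le> (1 - norm w) / (1 + norm w)" using w by (simp add: field_simps add_pos_nonneg)
      then have "a * (3/5) \<le> a * ((1 - norm w) / (1 + norm w))" using a5 by (intro mult_left_mono) auto
      then have "4 \<le> norm (1 + of_real r * p w)"
        using norm_factor_ge_Harnack[OF lt1[OF w]] a5 by (simp only: times_divide_eq_right)
      then have "norm z / norm (1 + of_real r * p w) \<le> 1 / 4" using z by (intro frac_le) auto
      then show "T w \<in> cball 0 (1/4)" by (simp add: T_def norm_divide)
    qed
    show "dist (T x) (T y) \<le> 8 / 15 * dist x y" if xy: "x \<in> cball 0 (1/4)" "y \<in> cball 0 (1/4)" for x y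
    proof -
      have "norm (T x - T y) \<le> 8 / 15 * norm (x - y)"
      proof (rule field_differentiable_bound[OF convex_cball _ _ xy])
        fix w :: complex assume w: "w \<in> cball 0 (1/4)"
        note w1 = lt1[OF w]
        let ?F = "1 + of_real r * p w"
        let ?T' = "- (z * (of_real r * deriv p w)) / ?F\<^sup>2"
        have dp: "(p has_field_derivative deriv p w) (at w)"
          by (rule holomorphic_derivI[OF holp]) (use w1 in auto)
        show "(T has_field_derivative ?T') (at w within cball 0 (1/4))"
        proof -
          have "((\<lambda>w. 1 + of_real r * p w) has_field_derivative of_real r * deriv p w) (at w)"
            using DERIV_add[OF DERIV_const DERIV_cmult[OF dp]] by simp
          from DERIV_divide[OF DERIV_const[of z] this factor_nonzero[OF w1]]
          have "(T has_field_derivative ?T') (at w)" unfolding T_def by (simp add: power2_eq_square)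
          then show ?thesis by (rule has_field_derivative_at_within)
        qed
        define s where "s = r * Re (p w)"
        have s: "s > 0" using Rep[OF w1] r by (simp add: s_def)
        have "norm z * (r * norm (deriv p w)) \<le> 1 * (2 / (1 - (norm w)\<^sup>2) * s)"
          unfolding s_def by (rule mult_mono[OF _ deriv_factor_bound[OF w1]]) (use z r in auto)
        also have "\<dots> \<le> 2 / (15/16) * s"
        proof -
          have "(norm w)\<^sup>2 \<le> (1/4)\<^sup>2" using w by (intro power_mono) auto
          then have "2 / (1 - (norm w)\<^sup>2) \<le> 2 / (15/16)" by (intro divide_left_mono) (auto simp: power2_eq_square)
          then show ?thesis unfolding mult_1_left using s by (intro mult_right_mono) auto
        qed
        also have "\<dots> \<le> 8 / 15 * (1 + s)\<^sup>2"
          using sum_squares_ge_zero[of "1 - s" 0] by (simp add: power2_eq_square algebra_simps)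
        also have "\<dots> \<le> 8 / 15 * (norm ?F)\<^sup>2"
          using norm_factor_ge[of w] s by (intro mult_left_mono power_mono) (auto simp: s_def)
        finally have "norm z * (r * norm (deriv p w)) / (norm ?F)\<^sup>2 \<le> 8 / 15"
          using factor_nonzero[OF w1] by (simp add: divide_le_eq)
        then show "norm ?T' \<le> 8 / 15"
          using r by (simp add: norm_divide norm_mult norm_power)
      qed
      then show ?thesis by (simp add: dist_norm)
    qed
  qed auto
  then obtain w where w: "w \<in> cball 0 (1/4)" "T w = w"
    and uniq: "\<And>v. v \<in> cball 0 (1/4) \<Longrightarrow> T v = v \<Longrightarrow> v = w" by metis
  show ?thesis
  proof (rule ex1I[of _ w])
    show "norm w < 1 \<and> H w = z" using w lt1 fixed_iff by auto
    show "v = w" if "norm v < 1 \<and> H v = z" for v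
      using uniq[of v] that fixed_iff[of v] preimage_quarter[of v] z by auto
  qed
qed

lemma H_has_derivative:
  assumes w: "norm w < 1"
  shows "(H has_field_derivative (1 + of_real r * p w) + w * (of_real r * deriv p w)) (at w)"
proof -
  have dp: "(p has_field_derivative deriv p w) (at w)"
    by (rule holomorphic_derivI[OF holp]) (use w in auto)
  show ?thesis unfolding H_def using dp by (auto intro!: derivative_eq_intros)
qed

text \<open>This quantity is \<open>w H' w / H w - 1\<close>. The numerator is bounded by the Schwarz-Pick estimate for \<open>p'\<close>, the
  denominator from below by \<open>1 + r Re (p w) > r Re (p w)\<close>; the factor \<open>r Re (p w)\<close> cancels and only the smallness
  of \<open>|w|\<close> matters.\<close>

lemma log_derivative_bound:
  assumes w: "norm w < 1" and Hw: "norm (H w) < 1"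
  shows "norm (w * (of_real r * deriv p w) / (1 + of_real r * p w)) < A_quot a"
proof (cases "w = 0")
  case True
  then show ?thesis using A_quot_pos a5 by simp
next
  case False
  define s where "s = r * Re (p w)"
  have s: "s > 0" using Rep[OF w] r by (simp add: s_def)
  have x: "1 - (norm w)\<^sup>2 > 0" using w by (simp add: power_less_one_iff)
  have "norm w * (r * norm (deriv p w)) \<le> norm w * (2 / (1 - (norm w)\<^sup>2) * s)"
    using deriv_factor_bound[OF w] by (intro mult_left_mono) (auto simp: s_def)
  also have "\<dots> = 2 * norm w / (1 - (norm w)\<^sup>2) * s" by simp
  also have "\<dots> < 2 * norm w / (1 - (norm w)\<^sup>2) * norm (1 + of_real r * p w)"
    using norm_factor_ge[of w] False x by (intro mult_strict_left_mono) (auto simp: s_def)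
  also have "\<dots> \<le> A_quot a * norm (1 + of_real r * p w)"
    using radius_bound_le_A_quot[OF a5 _ preimage_small[OF w Hw]] by (intro mult_right_mono) auto
  finally show ?thesis
    using factor_nonzero[OF w] r by (simp add: norm_divide norm_mult divide_less_eq)
qed

text \<open>With \<open>z = H w\<close> and \<open>G' z = 1 / H' w\<close>, the reciprocal of \<open>z G' z / G z\<close> is \<open>w H' w / H w\<close>. The equations
  \<open>H (G z) = z\<close> determine \<open>G\<close> only inside the disc, so its derivative is read off from the holomorphic
  inverse \<open>g\<close> of \<open>H\<close> that agrees with it there.\<close>

lemma resolvent_properties:
  assumes G: "\<And>z. norm z < 1 \<Longrightarrow> norm (G z) < 1 \<and> H (G z) = z"
  shows "normalized_on_disc G"
    and "norm z < 1 \<Longrightarrow> starlike_quot G z \<noteq> 0 \<and> norm (1 / starlike_quot G z - 1) < A_quot a"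
proof -
  define S where "S = {w. norm w < 1 \<and> norm (H w) < 1}"
  have holH: "H holomorphic_on unit_disc"
    unfolding H_def by (intro holomorphic_intros holp)
  have "S = unit_disc \<inter> H -` unit_disc" by (auto simp: S_def)
  then have opS: "open S"
    using continuous_open_preimage[OF holomorphic_on_imp_continuous_on[OF holH]] by simp
  have inj: "inj_on H S"
  proof (rule inj_onI)
    fix x y assume "x \<in> S" "y \<in> S" "H x = H y"
    then show "x = y" using unique_preimage[of "H x"] by (auto simp: S_def)
  qed
  have img: "H ` S = unit_disc"
  proof
    show "unit_disc \<subseteq> H ` S"
    proof
      fix z :: complex assume "z \<in> unit_disc"
      then have "G z \<in> S" "z = H (G z)" using G[of z] by (auto simp: S_def)
      then show "z \<in> H ` S" by blast
    qed
  qed (auto simp: S_def)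
  have "H holomorphic_on S" using holH by (rule holomorphic_on_subset) (auto simp: S_def)
  from holomorphic_has_inverse[OF this opS inj] obtain g where g: "g holomorphic_on unit_disc"
    "\<And>w. w \<in> S \<Longrightarrow> deriv H w * deriv g (H w) = 1" "\<And>w. w \<in> S \<Longrightarrow> g (H w) = w"
    unfolding img by metis
  have GS: "G z \<in> S" if "norm z < 1" for z using G[OF that] that by (simp add: S_def)
  have gG: "g z = G z" if "norm z < 1" for z
    using g(3)[OF GS[OF that]] G[OF that] by simp
  have holG: "G holomorphic_on unit_disc"
    by (rule holomorphic_transform[OF g(1)]) (use gG in auto)
  have dG: "deriv H (G z) * deriv G z = 1" if z: "norm z < 1" for z
  proof -
    have "\<forall>\<^sub>F y in nhds z. G y = g y"
      using eventually_nhds_in_open[of unit_disc z] z by (auto elim!: eventually_mono simp: gG)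
    then have "deriv G z = deriv g z" by (intro deriv_cong_ev) auto
    then show ?thesis using g(2)[OF GS[OF z]] G[OF z] by simp
  qed
  have G0: "G 0 = 0"
    using unique_preimage[of 0] G[of 0] by (metis H_def mult_zero_left norm_zero zero_less_one)
  show "normalized_on_disc G"
    unfolding normalized_on_disc_def using holG G0 dG[of 0] by auto
  show "starlike_quot G z \<noteq> 0 \<and> norm (1 / starlike_quot G z - 1) < A_quot a" if z: "norm z < 1"
  proof -
    define w where "w = G z"
    have w: "norm w < 1" "norm (H w) < 1" "H w = z" using G[OF z] z by (auto simp: w_def)
    let ?F = "1 + of_real r * p w" let ?u = "w * (of_real r * deriv p w)"
    have bd: "norm (?u / ?F) < A_quot a" by (rule log_derivative_bound[OF w(1,2)])
    show ?thesis
    proof (cases "z = 0")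
      case True
      have "0 < A_quot a" using bd norm_ge_zero by (rule le_less_trans[rotated])
      then show ?thesis using True by (simp add: starlike_quot_def)
    next
      case False
      then have w0: "w \<noteq> 0" using w(3) by (auto simp: H_def)
      have F: "?F \<noteq> 0" by (rule factor_nonzero[OF w(1)])
      have "deriv H w = ?F + ?u" using H_has_derivative[OF w(1)] by (rule DERIV_imp_deriv)
      then have dd: "(?F + ?u) * deriv G z = 1" using dG[OF z] by (simp add: w_def)
      then have dG0: "deriv G z \<noteq> 0" by auto
      have Q: "starlike_quot G z = ?F * deriv G z"
      proof -
        have "starlike_quot G z = H w * deriv G z / w"
          using False w(3) by (simp add: starlike_quot_def flip: w_def)
        then show ?thesis using w0 by (simp add: H_def)
      qed
      have "1 / (?F * deriv G z) - 1 = ?u / ?F"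
      proof -
        have "1 / deriv G z = ?F + ?u" using dd dG0 by (metis nonzero_eq_divide_eq)
        then have "1 / (?F * deriv G z) = (?F + ?u) / ?F" by (metis divide_divide_eq_left mult.commute)
        also have "\<dots> = 1 + ?u / ?F" unfolding add_divide_distrib[of ?F ?u ?F] divide_self[OF F] ..
        finally show ?thesis by simp
      qed
      then show ?thesis using bd F dG0 by (simp add: Q)
    qed
  qed
qed

end

section \<open>Spirallikeness and starlikeness of resolvents\<close>

theorem corollary4p1:
  fixes q :: complex and r :: real and G :: "complex \<Rightarrow> complex"
  assumes "Re q > 0" and "r > 0"
    and "G \<in> resolvent_family q r"
    and "r * Re q > r0"
  shows "(r * Re q \<ge> 6 \<longrightarrow>
           (\<forall>\<theta>::real. \<bar>\<theta>\<bar> \<le> arccos (6 / (r * Re q)) \<longrightarrow>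
              spirallike_of_order \<theta>
                ((cos \<theta> - A_quot (r * Re q)) / ((1 - (A_quot (r * Re q))\<^sup>2) * cos \<theta>)) G))
       \<and> starlike_of_order (1 / (1 + A_quot (r * Re q))) G
       \<and> strongly_starlike_of_order (2 / pi * arcsin (A_quot (r * Re q))) G"
proof -
  define a where "a = r * Re q"
  define A where "A = A_quot a"
  have a5: "a > 5" using five_less_r0 assms(4) by (simp add: a_def)
  have A: "0 < A" "A < 1" using A_quot_pos[of a] A_quot_less_1[of a] a5 assms(4) by (auto simp: A_def a_def)
  have A2: "1 - A\<^sup>2 > 0" using A by (simp add: power_less_one_iff)
  obtain f where gen: "generator f" and f0: "f 0 = 0" and f': "deriv f 0 = q" and Gf: "G = resolvent r f"
    using assms(3) by (auto simp: resolvent_family_def)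
  have holf: "f holomorphic_on unit_disc" using gen by (simp add: generator_def)
  have "Re (deriv f 0) > 0" using assms(1) f' by simp
  from generator_eq_id_times[OF generator_Re_nonneg[OF gen f0] holf f0 this]
  obtain p where p: "p holomorphic_on unit_disc" "\<And>z. norm z < 1 \<Longrightarrow> f z = z * p z" "p 0 = q"
    "\<And>z. norm z < 1 \<Longrightarrow> Re (p z) > 0" using f' by metis
  interpret half_plane_resolvent p r a
    by unfold_locales (use p assms a5 in \<open>auto simp: a_def\<close>)
  have H: "w + of_real r * f w = H w" if "norm w < 1" for w
    using p(2)[OF that] by (simp add: H_def algebra_simps)
  have G: "norm (G z) < 1 \<and> H (G z) = z" if z: "norm z < 1" for z
  proof -
    obtain w where w: "norm w < 1" "H w = z" using unique_preimage[OF z] by blast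
    then have "z \<in> (\<lambda>w. w + of_real r * f w) ` unit_disc" using H by (force simp: image_iff)
    from f_inv_into_f[OF this] inv_into_into[OF this]
    show ?thesis using H[of "G z"] by (simp add: Gf resolvent_def)
  qed
  have norm: "normalized_on_disc G"
    and Q: "\<And>z. norm z < 1 \<Longrightarrow> starlike_quot G z \<noteq> 0" "\<And>z. norm z < 1 \<Longrightarrow> norm (1 / starlike_quot G z - 1) < A"
    using resolvent_properties[OF G] A by (auto simp: A_def)
  have rot: "Re (exp (- (\<i> * of_real \<theta>)) * starlike_quot G z) > (cos \<theta> - A) / (1 - A\<^sup>2)"
    if "norm z < 1" for \<theta> z
    using reciprocal_disc_rotated_Re[OF A Q[OF that]] .
  have "spirallike_of_order \<theta> ((cos \<theta> - A) / ((1 - A\<^sup>2) * cos \<theta>)) G"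
    if a6: "a \<ge> 6" and \<theta>: "\<bar>\<theta>\<bar> \<le> arccos (6 / a)" for \<theta>
  proof -
    have "cos (arccos (6 / a)) \<le> cos \<bar>\<theta>\<bar>"
      using \<theta> a6 arccos_ubound[of "6 / a"] by (intro cos_monotone_0_pi_le) (auto simp: field_simps)
    moreover have "cos (arccos (6 / a)) = 6 / a" using a6 by (intro cos_arccos) (auto simp: field_simps)
    ultimately have cA: "A < cos \<theta>" using A_quot_less_6_over[OF a6] by (simp add: A_def)
    then have c0: "cos \<theta> > 0" using A by linarith
    \<comment> \<open>The order is less than 1 because \<open>A cos \<theta> < 1\<close>.\<close>
    have "A * cos \<theta> < 1 * 1" using A c0 by (intro mult_less_le_imp_less) auto
    then have "A * (A * cos \<theta>) < A * 1" using A by (intro mult_strict_left_mono) auto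
    then have "cos \<theta> - A < (1 - A\<^sup>2) * cos \<theta>" by (simp add: power2_eq_square algebra_simps)
    then have "(cos \<theta> - A) / ((1 - A\<^sup>2) * cos \<theta>) < 1" using A2 c0 by simp
    then show ?thesis
      unfolding spirallike_of_order_def using norm cA A2 c0 rot by auto
  qed
  moreover have "starlike_of_order (1 / (1 + A)) G"
  proof -
    \<comment> \<open>The case \<open>\<theta> = 0\<close> of the rotated estimate.\<close>
    have "(1 - A) / (1 - A\<^sup>2) = 1 / (1 + A)"
      using A A2 by (simp add: field_simps power2_eq_square)
    then show ?thesis
      unfolding starlike_of_order_def using norm A rot[of _ 0] by auto
  qed
  moreover have "strongly_starlike_of_order (2 / pi * arcsin A) G"
  proof -
    have "0 < arcsin A" "arcsin A < pi / 2"
      using A arcsin_less_arcsin[of 0 A] arcsin_less_arcsin[of A 1] by auto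
    then show ?thesis
      unfolding strongly_starlike_of_order_def
      using norm Q reciprocal_disc_Arg[OF A Q] by (auto simp: field_simps)
  qed
  ultimately show ?thesis unfolding A_def a_def by blast
qed

end
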